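(* For every integer $s\ge 2$, the unique degree-maximizing partition of $T_s+2$ (the unique $\lambda\vdash T_s+2$ with $\deg(\lambda)=\Delta_{T_s+2}$) is $$(s+1,s-1,s-2,\dots,2,1^2).$$ In particular, there is exactly $1$ degree-maximizing partition of $T_s+2$.
   Context: For an integer $m\ge 0$, $T_m:=m(m+1)/2$. Exponents denote multiplicities. The displayed partition is the staircase $(s,s-1,\dots,1)$ with its largest part increased by $1$ and with an additional part $1$ (for $s=2$ it is $(3,1^2)$). Partition graph: for $n\ge 1$, $G_n$ is the simple graph whose vertices are the integer partitions of $n$; two distinct partitions are adjacent if one is obtained from the other by an elementary transfer of one unit from one part to another (subtract $1$ from one part and add $1$ to another part), followed by reordering. Here the receiving part may be a zero part (so a new part $1$ may be created), and parts that become $0$ are discarded. $\deg(\lambda)$ is the degree of $\lambda$ in $G_n$, and $\Delta_n:=\max_{\lambda\vdash n}\deg(\lambda)$. *)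

theory Defs
  imports "HOL-Library.Multiset"
begin

definition triangular :: "nat \<Rightarrow> nat" where
  "triangular m = m * (m + 1) div 2"

text \<open>An integer partition is the finite multiset of its (positive) parts.\<close>

definition partitions :: "nat \<Rightarrow> nat multiset set" where
  "partitions n = {p. 0 \<notin># p \<and> sum_mset p = n}"

text \<open>
  One unit moves from the part \<open>a\<close> to a different part \<open>b\<close> (different as an occurrence,
  so the values may agree). The extra \<open>0\<close> is the zero part that may receive the unit;
  the filter discards zero parts, in particular the extra one when it is not used.
\<close>

definition transfer :: "nat multiset \<Rightarrow> nat multiset \<Rightarrow> bool" where
  "transfer p q \<longleftrightarrow>
     (\<exists>a b. a \<in># p \<and> b \<in># add_mset 0 (p - {#a#}) \<and>
        q = filter_mset (\<lambda>x. x \<noteq> 0) (add_mset 0 p - {#a, b#} + {#a - 1, b + 1#}))"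

definition adjacent :: "nat multiset \<Rightarrow> nat multiset \<Rightarrow> bool" where
  "adjacent p q \<longleftrightarrow> p \<noteq> q \<and> (transfer p q \<or> transfer q p)"

definition deg :: "nat \<Rightarrow> nat multiset \<Rightarrow> nat" where
  "deg n p = card {q \<in> partitions n. adjacent p q}"

definition max_deg :: "nat \<Rightarrow> nat" where
  "max_deg n = Max (deg n ` partitions n)"

definition degree_maximizing :: "nat \<Rightarrow> nat multiset \<Rightarrow> bool" where
  "degree_maximizing n p \<longleftrightarrow> p \<in> partitions n \<and> deg n p = max_deg n"

lemma finite_partitions: "finite (partitions n)"
proof (rule finite_subset)
  show "partitions n \<subseteq> mset ` {xs. set xs \<subseteq> {..n} \<and> length xs \<le> n}"
  proof
    fix l assume l: "l \<in> partitions n"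
    obtain xs where xs: "l = mset xs" by (metis ex_mset)
    have z: "0 \<notin> set xs" and s: "sum_list xs = n"
      using l by (auto simp: partitions_def xs sum_mset_sum_list)
    have "set xs \<subseteq> {..n}" using s member_le_sum_list by fastforce
    moreover have "0 \<notin> set ys \<Longrightarrow> length ys \<le> sum_list ys" for ys :: "nat list"
      by (induction ys) auto
    then have "length xs \<le> n" using z s by blast
    ultimately show "l \<in> mset ` {xs. set xs \<subseteq> {..n} \<and> length xs \<le> n}"
      using xs by blast
  qed
  show "finite (mset ` {xs. set xs \<subseteq> {..n} \<and> length xs \<le> n})"
    by (intro finite_imageI finite_lists_length_le) simp
qed

end

theory Submission
  imports Defs
begin

text \<open>
  A partition \<open>p\<close> with \<open>r\<close> distinct part sizes, \<open>m\<close> of them repeated, and \<open>g\<close> of them having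
  a predecessor that is neither \<open>0\<close> nor a part, satisfies \<open>deg p = r (r - 1) + m + g\<close>: distinct
  transfers give distinct results, since moving a unit from \<open>a\<close> to \<open>b\<close> changes the conjugate
  partition by \<open>- 1\<close> at \<open>a\<close> and \<open>+ 1\<close> at \<open>b + 1\<close>.
  As \<open>m, g \<le> r\<close>, fewer than \<open>s\<close> sizes give degree at most \<open>s (s - 1)\<close>, and more than \<open>s\<close> sizes do
  not fit. For \<open>r = s\<close> the sum exceeds its minimum \<open>triangular s\<close> by \<open>2\<close>; the repeated parts
  use up at least \<open>triangular m\<close> of this excess and the gaps at least \<open>g\<close>, which forces
  \<open>m = g = 1\<close> as soon as \<open>m + g \<ge> 2\<close>, with a single solution.
\<close>

section \<open>Neighbours and the degree formula\<close>

abbreviation nonzero :: "nat multiset \<Rightarrow> nat multiset" where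
  "nonzero \<equiv> filter_mset (\<lambda>x. x \<noteq> 0)"

definition move :: "nat multiset \<Rightarrow> nat \<times> nat \<Rightarrow> nat multiset" where
  "move p = (\<lambda>(a, b). nonzero (add_mset 0 p - {#a, b#} + {#a - 1, b + 1#}))"

text \<open>Donor and receiver values of the transfers that really change \<open>p\<close>; receiver
  \<open>0\<close> is the zero part. For \<open>a = b + 1\<close> the two values merely trade
  places, and \<open>a = b\<close> needs a second copy.\<close>

definition moves :: "nat multiset \<Rightarrow> (nat \<times> nat) set" where
  "moves p = {(a, b). a \<in># p \<and> b \<in> insert 0 (set_mset p) \<and> a \<noteq> b + 1 \<and> (a = b \<longrightarrow> count p a \<noteq> 1)}"

definition repeated :: "nat multiset \<Rightarrow> nat set" where
  "repeated p = {x \<in> set_mset p. count p x \<noteq> 1}"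

definition gap_tops :: "nat set \<Rightarrow> nat set" where
  "gap_tops S = {x \<in> S. x - 1 \<notin> insert 0 S}"

lemma nonzero_id: "0 \<notin># p \<Longrightarrow> nonzero p = p"
  by (induction p) auto

lemma pair_subset_iff:
  assumes "a \<in># p"
  shows "{#a, b#} \<subseteq># add_mset 0 p \<longleftrightarrow> b \<in># add_mset 0 (p - {#a#})"
proof -
  have "add_mset 0 p - {#a#} = add_mset 0 (p - {#a#})" using assms by simp
  moreover have "a \<in># add_mset 0 p" using assms by simp
  ultimately show ?thesis by (simp only: insert_subset_eq_iff[of a "{#b#}"] single_subset_iff simp_thms)
qed

lemma in_remove_iff:
  assumes "a \<in># p" "a \<noteq> 0"
  shows "b \<in># add_mset 0 (p - {#a#}) \<longleftrightarrow> b \<in> insert 0 (set_mset p) \<and> (a = b \<longrightarrow> count p a \<noteq> 1)"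
proof (cases "a = b")
  case True
  have "count p a > 0" using assms by simp
  moreover have "a \<in># p - {#a#} \<longleftrightarrow> 1 < count p a" by (simp add: in_diff_count)
  ultimately have "a \<in># p - {#a#} \<longleftrightarrow> count p a \<noteq> 1" by linarith
  then show ?thesis using True assms by simp
next
  case False
  then show ?thesis by (simp add: in_diff_count)
qed

lemma transfer_iff:
  assumes "0 \<notin># p"
  shows "transfer p q \<longleftrightarrow>
    (\<exists>R a b. a > 0 \<and> p = nonzero (R + {#a, b#}) \<and> q = nonzero (R + {#a - 1, b + 1#}))"
    (is "_ \<longleftrightarrow> ?rhs")
proof
  assume "transfer p q"
  then obtain a b where ab: "a \<in># p" "b \<in># add_mset 0 (p - {#a#})"
    and q: "q = nonzero (add_mset 0 p - {#a, b#} + {#a - 1, b + 1#})"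
    unfolding transfer_def by blast
  let ?R = "add_mset 0 p - {#a, b#}"
  have "a > 0" using ab assms by (metis gr0I)
  have "?R + {#a, b#} = add_mset 0 p"
    using ab by (intro subset_mset.diff_add) (simp only: pair_subset_iff)
  then have "nonzero (?R + {#a, b#}) = nonzero (add_mset 0 p)" by (rule arg_cong)
  then have "p = nonzero (?R + {#a, b#})" using nonzero_id[OF assms] by simp
  with q \<open>a > 0\<close> show ?rhs by blast
next
  assume ?rhs
  then obtain R a b where h: "a > 0" "p = nonzero (R + {#a, b#})"
    "q = nonzero (R + {#a - 1, b + 1#})" by blast
  have "a \<in># p" using h by simp
  moreover have "b \<in># add_mset 0 (p - {#a#})" using h by (cases "b = 0") auto
  moreover have "q = nonzero (add_mset 0 p - {#a, b#} + {#a - 1, b + 1#})"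
  \<comment> \<open>For \<open>b = 0\<close> the auxiliary zero is the receiver and gets subtracted;
    otherwise it stays in the rest until the filter discards it.\<close>
  proof (cases "b = 0")
    case True
    then show ?thesis using h by (simp add: filter_filter_mset add_mset_commute[of 0])
  next
    case False
    then have "add_mset 0 p - {#a, b#} = add_mset 0 (nonzero R)"
      using h by (simp add: add_mset_commute[of 0])
    then show ?thesis using h by (simp add: filter_filter_mset)
  qed
  ultimately show "transfer p q" unfolding transfer_def by blast
qed

lemma transfer_sym:
  assumes "0 \<notin># p" "0 \<notin># q" "transfer p q"
  shows "transfer q p"
proof -
  obtain R a b where h: "a > 0" "p = nonzero (R + {#a, b#})" "q = nonzero (R + {#a - 1, b + 1#})"
    using assms(3) transfer_iff[OF assms(1)] by blast
  \<comment> \<open>The unit goes back from \<open>b + 1\<close> to \<open>a - 1\<close>; for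
    \<open>a = 1\<close> the receiver is the zero part.\<close>
  then have "b + 1 > 0 \<and> q = nonzero (R + {#b + 1, a - 1#}) \<and> p = nonzero (R + {#b + 1 - 1, a - 1 + 1#})"
    by (simp add: add_mset_commute)
  then show ?thesis unfolding transfer_iff[OF assms(2)] by (intro exI)
qed

text \<open>Both values of a pair in \<open>moves p\<close> occur in \<open>add_mset 0 p\<close> as
  different occurrences, so the truncated multiset subtraction in \<open>move\<close> loses
  nothing.\<close>

lemma move_decomp:
  assumes "(a, b) \<in> moves p" "0 \<notin># p"
  obtains R where "add_mset 0 p = R + {#a, b#}" "move p (a, b) = nonzero (R + {#a - 1, b + 1#})"
proof
  have "a \<in># p" using assms by (simp add: moves_def)
  moreover have "a \<noteq> 0" using calculation assms(2) by metis
  ultimately have "{#a, b#} \<subseteq># add_mset 0 p"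
    using assms(1) in_remove_iff[of a p b] by (simp add: pair_subset_iff moves_def)
  then show "add_mset 0 p = add_mset 0 p - {#a, b#} + {#a, b#}" by (simp only: subset_mset.diff_add)
  show "move p (a, b) = nonzero (add_mset 0 p - {#a, b#} + {#a - 1, b + 1#})"
    by (simp add: move_def)
qed

text \<open>The number of parts \<ge> \<open>k\<close> is the \<open>k\<close>-th part of the
  conjugate partition. Lowering \<open>a\<close> affects it only at \<open>k = a\<close>, raising
  \<open>b\<close> only at \<open>k = b + 1\<close>; zeros never count because
  \<open>k > 0\<close>.\<close>

lemma conjugate_move:
  assumes "(a, b) \<in> moves p" "0 \<notin># p" "k > 0"
  shows "size (filter_mset (\<lambda>x. k \<le> x) (move p (a, b))) + of_bool (k = a) =
         size (filter_mset (\<lambda>x. k \<le> x) p) + of_bool (k = b + 1)"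
proof -
  let ?N = "\<lambda>q. size (filter_mset (\<lambda>x. k \<le> x) q)"
  obtain R where R: "add_mset 0 p = R + {#a, b#}" "move p (a, b) = nonzero (R + {#a - 1, b + 1#})"
    using move_decomp assms by blast
  have "a > 0" using assms unfolding moves_def by (auto intro: gr0I)
  have "?N (add_mset 0 p) = ?N (R + {#a, b#})" unfolding R(1) ..
  then have "?N p = ?N R + of_bool (k \<le> a) + of_bool (k \<le> b)"
    using assms(3) by auto
  moreover have "?N (move p (a, b)) = ?N R + of_bool (k \<le> a - 1) + of_bool (k \<le> b + 1)"
  proof -
    have "(\<lambda>x. x \<noteq> 0 \<and> k \<le> x) = (\<lambda>x. k \<le> x)" using assms(3) by auto
    then show ?thesis unfolding R(2) using assms(3) by (simp add: filter_filter_mset conj_commute)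
  qed
  ultimately show ?thesis using \<open>a > 0\<close> assms(3) by (auto simp: of_bool_def)
qed

lemma inj_on_move:
  assumes "0 \<notin># p"
  shows "inj_on (move p) (moves p)"
proof (rule inj_onI, clarify)
  fix a b c d
  assume h: "(a, b) \<in> moves p" "(c, d) \<in> moves p" "move p (a, b) = move p (c, d)"
  have ne: "a \<noteq> b + 1" "c \<noteq> d + 1" "a > 0" "c > 0"
    using h assms by (auto simp: moves_def intro: gr0I)
  have eq: "of_bool (k = b + 1) + of_bool (k = c) = (of_bool (k = d + 1) + of_bool (k = a) :: nat)"
    if "k > 0" for k
    using conjugate_move[OF h(1) assms that] conjugate_move[OF h(2) assms that] h(3) by simp
  \<comment> \<open>At \<open>k = a\<close> the right side is positive and \<open>b + 1\<close>
    differs from \<open>a\<close>, which forces \<open>c = a\<close>. At \<open>k = b + 1\<close>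
    the left side is positive, which forces \<open>d = b\<close>.\<close>
  have "a = c" using eq[of a] ne by (cases "a = c") simp_all
  moreover have "b = d" using eq[of "b + 1"] ne calculation by (cases "b = d") simp_all
  ultimately show "a = c \<and> b = d" ..
qed

lemma move_ne:
  assumes "0 \<notin># p" "(a, b) \<in> moves p"
  shows "move p (a, b) \<noteq> p"
proof
  assume "move p (a, b) = p"
  then have "of_bool (b + 1 = a) = (1::nat)"
    using conjugate_move[OF assms(2,1), of "b + 1"] by simp
  then show False using assms(2) by (simp add: moves_def)
qed

lemma sum_nonzero: "sum_mset (nonzero p) = sum_mset p"
  by (induction p) auto

lemma neighbours_eq:
  assumes "p \<in> partitions n"
  shows "{q \<in> partitions n. adjacent p q} = move p ` moves p"
proof
  have p: "0 \<notin># p" "sum_mset p = n" using assms by (auto simp: partitions_def)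
  show "{q \<in> partitions n. adjacent p q} \<subseteq> move p ` moves p"
  proof
    fix q assume "q \<in> {q \<in> partitions n. adjacent p q}"
    then have q: "0 \<notin># q" "p \<noteq> q" "transfer p q \<or> transfer q p"
      by (auto simp: partitions_def adjacent_def)
    then have "transfer p q" using transfer_sym p by blast
    then obtain a b where ab: "a \<in># p" "b \<in># add_mset 0 (p - {#a#})" "q = move p (a, b)"
      unfolding transfer_def move_def by auto
    have "a > 0" using ab p by (metis gr0I)
    then have b: "b \<in> insert 0 (set_mset p)" "a = b \<longrightarrow> count p a \<noteq> 1"
      using ab in_remove_iff[of a p b] by auto
    \<comment> \<open>Otherwise the added pair is the removed pair in the other order, and
      \<open>q\<close> would be \<open>p\<close>.\<close>
    moreover have "a \<noteq> b + 1"
    proof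
      assume "a = b + 1"
      have "add_mset 0 p - {#a, b#} + {#a, b#} = add_mset 0 p"
        using ab by (intro subset_mset.diff_add) (simp only: pair_subset_iff)
      moreover have "add_mset 0 p - {#a, b#} + {#a - 1, b + 1#} = add_mset 0 p - {#a, b#} + {#a, b#}"
        using \<open>a = b + 1\<close> by (simp add: add_mset_commute)
      ultimately have "q = nonzero (add_mset 0 p)" using ab(3) by (simp only: move_def prod.case)
      then show False using q(2) nonzero_id[OF p(1)] by simp
    qed
    ultimately show "q \<in> move p ` moves p" using ab by (auto simp: moves_def)
  qed
  show "move p ` moves p \<subseteq> {q \<in> partitions n. adjacent p q}"
  proof clarify
    fix a b assume ab: "(a, b) \<in> moves p"
    then have "a > 0" using p by (auto simp: moves_def intro: gr0I)
    obtain R where R: "add_mset 0 p = R + {#a, b#}" "move p (a, b) = nonzero (R + {#a - 1, b + 1#})"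
      using move_decomp[OF ab p(1)] by blast
    have "sum_mset (move p (a, b)) = n"
      using arg_cong[OF R(1), of sum_mset] p \<open>a > 0\<close> by (simp only: R(2) sum_nonzero) simp
    moreover have "0 \<notin># move p (a, b)" unfolding R(2) by simp
    moreover have "transfer p (move p (a, b))"
    proof -
      have "b \<in># add_mset 0 (p - {#a#})"
        using ab \<open>a > 0\<close> in_remove_iff[of a p b] by (simp add: moves_def)
      moreover have "a \<in># p" using ab by (simp add: moves_def)
      ultimately show ?thesis unfolding transfer_def move_def prod.case by blast
    qed
    ultimately show "move p (a, b) \<in> partitions n \<and> adjacent p (move p (a, b))"
      using move_ne[OF p(1) ab] by (auto simp: partitions_def adjacent_def)
  qed
qed

text \<open>Among the \<open>r * (r + 1)\<close> pairs of a part size with a part size or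
  \<open>0\<close>, those that are not moves are \<open>(x, x)\<close> for unrepeated
  \<open>x\<close> and \<open>(x, x - 1)\<close> for \<open>x\<close> with no gap below. Both kinds
  are counted by complements inside the \<open>r\<close> sizes.\<close>

lemma deg_formula:
  assumes "p \<in> partitions n"
  defines "r \<equiv> card (set_mset p)"
  shows "deg n p + r = r * r + card (repeated p) + card (gap_tops (set_mset p))"
proof -
  let ?S = "set_mset p"
  have p: "0 \<notin># p" using assms by (auto simp: partitions_def)
  define D where "D = ?S - repeated p"
  define E where "E = ?S - gap_tops ?S"
  have E_pos: "x \<noteq> 0" if "x \<in> E" for x using that p unfolding E_def by (metis DiffD1)
  have "moves p \<subseteq> ?S \<times> insert 0 ?S" by (auto simp: moves_def)
  then have fin: "finite (moves p)" "finite D" "finite E"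
    by (auto simp: D_def E_def dest: finite_subset)
  have "?S \<times> insert 0 ?S = moves p \<union> ((\<lambda>x. (x, x)) ` D \<union> (\<lambda>x. (x, x - 1)) ` E)"
  proof (rule set_eqI, clarify)
    fix a b
    have pred: "a = b + 1 \<longleftrightarrow> b = a - 1" if "a \<in># p"
    proof -
      have "a \<noteq> 0" using that p by metis
      then show ?thesis by auto
    qed
    have D: "(a, b) \<in> (\<lambda>x. (x, x)) ` D \<longleftrightarrow> a = b \<and> a \<in># p \<and> count p a = 1"
      by (auto simp: D_def repeated_def)
    have E: "(a, b) \<in> (\<lambda>x. (x, x - 1)) ` E \<longleftrightarrow> b = a - 1 \<and> a \<in># p \<and> b \<in> insert 0 ?S"
      by (auto simp: E_def gap_tops_def)
    have M: "(a, b) \<in> moves p \<longleftrightarrow>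
        a \<in># p \<and> b \<in> insert 0 ?S \<and> a \<noteq> b + 1 \<and> (a = b \<longrightarrow> count p a \<noteq> 1)"
      by (simp add: moves_def)
    show "(a, b) \<in> ?S \<times> insert 0 ?S \<longleftrightarrow>
        (a, b) \<in> moves p \<union> ((\<lambda>x. (x, x)) ` D \<union> (\<lambda>x. (x, x - 1)) ` E)"
    proof (cases "a \<in># p")
      case True
      then show ?thesis
        unfolding Un_iff mem_Times_iff fst_conv snd_conv D E M pred[OF True] by blast
    next
      case False
      then show ?thesis unfolding Un_iff mem_Times_iff fst_conv snd_conv D E M by blast
    qed
  qed
  then have "card (?S \<times> insert 0 ?S) = card (moves p \<union> ((\<lambda>x. (x, x)) ` D \<union> (\<lambda>x. (x, x - 1)) ` E))"
    by (rule arg_cong)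
  also have "\<dots> = card (moves p) + card ((\<lambda>x. (x, x)) ` D \<union> (\<lambda>x. (x, x - 1)) ` E)"
  proof (intro card_Un_disjoint)
    have "(x, x - 1) \<notin> moves p" if "x \<in> E" for x
      using E_pos[OF that] by (simp add: moves_def)
    moreover have "(x, x) \<notin> moves p" if "x \<in> D" for x
      using that by (simp add: moves_def D_def repeated_def)
    ultimately show "moves p \<inter> ((\<lambda>x. (x, x)) ` D \<union> (\<lambda>x. (x, x - 1)) ` E) = {}"
      by blast
  qed (use fin in auto)
  also have "card ((\<lambda>x. (x, x)) ` D \<union> (\<lambda>x. (x, x - 1)) ` E) =
      card ((\<lambda>x. (x, x)) ` D) + card ((\<lambda>x. (x, x - 1)) ` E)"
  proof (intro card_Un_disjoint)
    have "x \<noteq> x - 1" if "x \<in> E" for x using E_pos[OF that] by simp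
    then show "(\<lambda>x. (x, x)) ` D \<inter> (\<lambda>x. (x, x - 1)) ` E = {}" by blast
  qed (use fin in auto)
  also have "\<dots> = card D + card E"
    by (simp add: card_image inj_on_def)
  finally have "r * (r + 1) = card (moves p) + (card D + card E)"
    using p by (simp add: card_cartesian_product r_def)
  moreover have "card (?S - A) + card A = r" if "A \<subseteq> ?S" for A
    using that card_mono[of ?S A] finite_subset[OF that] by (simp add: card_Diff_subset r_def)
  then have "card D + card (repeated p) = r" "card E + card (gap_tops ?S) = r"
    unfolding D_def E_def by (simp_all add: repeated_def gap_tops_def)
  moreover have "deg n p = card (moves p)"
    unfolding deg_def neighbours_eq[OF assms(1)] by (rule card_image[OF inj_on_move[OF p]])
  ultimately show ?thesis by (simp add: algebra_simps)
qed

section \<open>Sums of sets of part sizes\<close>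

lemma triangular_eq_sum: "triangular m = \<Sum>{1..m}"
  by (simp add: triangular_def Sum_Icc_nat)

lemma triangular_Suc: "triangular (Suc m) = triangular m + Suc m"
  by (simp add: triangular_eq_sum)

lemma triangular_mono: "m \<le> k \<Longrightarrow> triangular m \<le> triangular k"
  unfolding triangular_eq_sum by (intro sum_mono2) auto

text \<open>Exchange argument: \<open>S\<close> and \<open>{1..card S}\<close> have equally many
  elements outside each other. Those of \<open>S\<close> are at least \<open>card S + 1\<close>,
  those of the interval at most \<open>card S\<close>, so each exchange costs at least one.\<close>

lemma sum_ge_triangular:
  fixes S :: "nat set"
  assumes "finite S" "0 \<notin> S"
  shows "triangular (card S) + card (S - {1..card S}) \<le> \<Sum>S"
proof -
  define A where "A = {1..card S}"
  have fA: "finite A" "card A = card S" by (auto simp: A_def)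
  have card_eq: "card (S - A) = card (A - S)"
    using card_Diff_subset_Int[of S A] card_Diff_subset_Int[of A S] assms fA by (simp add: Int_commute)
  have "\<Sum>A = \<Sum>(A \<inter> S) + \<Sum>(A - S)"
    using fA by (metis sum.Int_Diff)
  also have "\<Sum>(A - S) \<le> card (A - S) * card S"
    using sum_bounded_above[of "A - S" "\<lambda>x. x" "card S"] by (simp add: A_def)
  finally have 1: "\<Sum>A \<le> \<Sum>(A \<inter> S) + card (S - A) * card S" by (simp add: card_eq)
  have "card (S - A) * (card S + 1) \<le> \<Sum>(S - A)"
    using sum_bounded_below[of "S - A" "card S + 1" "\<lambda>x. x"] assms(2)
    by (force simp: A_def Suc_le_eq not_le intro: gr0I)
  moreover have "\<Sum>S = \<Sum>(A \<inter> S) + \<Sum>(S - A)"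
    using assms by (metis sum.Int_Diff Int_commute)
  ultimately have "\<Sum>A + card (S - A) \<le> \<Sum>S" using 1 by (simp add: algebra_simps)
  then show ?thesis by (simp add: A_def triangular_eq_sum)
qed

lemma eq_interval_of_sum_le:
  fixes S :: "nat set"
  assumes "finite S" "0 \<notin> S" "\<Sum>S \<le> triangular (card S)"
  shows "S = {1..card S}"
proof (rule card_subset_eq)
  have "card (S - {1..card S}) = 0" using sum_ge_triangular[OF assms(1,2)] assms(3) by linarith
  then show "S \<subseteq> {1..card S}" using assms(1) by auto
qed auto

text \<open>Each gap top slides down by one into its gap. The size of the set is kept and its sum
  drops by one per gap top, so the bound \<open>sum_ge_triangular\<close> for the new set improves
  the bound for \<open>S\<close>.\<close>

definition lower_gaps :: "nat set \<Rightarrow> nat set" where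
  "lower_gaps S = (S - gap_tops S) \<union> (\<lambda>x. x - 1) ` gap_tops S"

text \<open>No collisions occur: the predecessor of a gap top is positive and outside
  \<open>S\<close>, and distinct gap tops have distinct predecessors.\<close>

lemma lower_gaps:
  assumes "finite S" "0 \<notin> S"
  shows "finite (lower_gaps S)" "0 \<notin> lower_gaps S" "card (lower_gaps S) = card S"
    "\<Sum>(lower_gaps S) + card (gap_tops S) = \<Sum>S"
proof -
  let ?G = "gap_tops S"
  have G: "finite ?G" "?G \<subseteq> S" using assms by (auto simp: gap_tops_def)
  have inj: "inj_on (\<lambda>x::nat. x - 1) ?G"
    using assms(2) G by (intro inj_onI) (metis One_nat_def Suc_pred gr0I subsetD)
  have dj: "(S - ?G) \<inter> (\<lambda>x. x - 1) ` ?G = {}" by (auto simp: gap_tops_def)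
  show "finite (lower_gaps S)" "0 \<notin> lower_gaps S"
    using assms by (auto simp: lower_gaps_def gap_tops_def)
  show "card (lower_gaps S) = card S"
    unfolding lower_gaps_def using dj assms G inj
    by (simp add: card_Un_disjoint card_image card_Diff_subset card_mono)
  have "\<Sum>(lower_gaps S) = \<Sum>(S - ?G) + (\<Sum>x\<in>?G. x - 1)"
    unfolding lower_gaps_def using dj assms G inj by (simp add: sum.union_disjoint sum.reindex)
  moreover have "(\<Sum>x\<in>?G. x - 1) + card ?G = \<Sum>?G"
  proof -
    have "(\<Sum>x\<in>?G. x - 1) + card ?G = (\<Sum>x\<in>?G. x - 1 + 1)" by (simp add: sum.distrib del: One_nat_def)
    also have "\<dots> = \<Sum>?G" using assms(2) G by (intro sum.cong) (auto intro!: Suc_pred gr0I)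
    finally show ?thesis .
  qed
  moreover have "\<Sum>S = \<Sum>(S - ?G) + \<Sum>?G" using assms G by (simp add: sum.subset_diff)
  ultimately show "\<Sum>(lower_gaps S) + card ?G = \<Sum>S" by simp
qed

lemma triangular_add_gaps_le:
  assumes "finite S" "0 \<notin> S"
  shows "triangular (card S) + card (gap_tops S) \<le> \<Sum>S"
  using sum_ge_triangular[of "lower_gaps S"] lower_gaps[OF assms] by simp

text \<open>Tightness makes the lowered set the initial interval. A gap top has its predecessor in
  that set but is itself not in it, so it lies just above the interval.\<close>

lemma gap_tops_of_tight_sum:
  assumes "finite S" "0 \<notin> S" "\<Sum>S \<le> triangular (card S) + card (gap_tops S)"
  shows "gap_tops S \<subseteq> {card S + 1}" and "lower_gaps S = {1..card S}"
proof -
  let ?G = "gap_tops S"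
  have "\<Sum>(lower_gaps S) \<le> triangular (card (lower_gaps S))"
    using lower_gaps(3,4)[OF assms(1,2)] assms(3) by simp
  then show eq: "lower_gaps S = {1..card S}"
    using eq_interval_of_sum_le[of "lower_gaps S"] lower_gaps[OF assms(1,2)] by simp
  show "?G \<subseteq> {card S + 1}"
  proof
    fix x assume x: "x \<in> ?G"
    then have "x - 1 \<in> lower_gaps S" by (simp add: lower_gaps_def)
    then have "x - 1 \<le> card S" "x - 1 \<ge> 1" unfolding eq by auto
    moreover have "x \<notin> lower_gaps S"
    proof
      assume "x \<in> lower_gaps S"
      then obtain y where "y \<in> ?G" "x = y - 1" using x by (auto simp: lower_gaps_def)
      then show False using x by (auto simp: gap_tops_def)
    qed
    then have "\<not> x \<le> card S" using \<open>x - 1 \<ge> 1\<close> unfolding eq by auto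
    ultimately show "x \<in> {card S + 1}" by auto
  qed
qed

lemma eq_of_tight_sum_one_gap:
  assumes "finite S" "0 \<notin> S" "\<Sum>S \<le> triangular (card S) + 1" "card (gap_tops S) = 1"
  shows "S = insert (card S + 1) {1..card S - 1}"
proof -
  let ?G = "gap_tops S" and ?r = "card S"
  have *: "?G \<subseteq> {?r + 1}" and eq: "lower_gaps S = {1..?r}"
    using gap_tops_of_tight_sum[of S] assms by auto
  have G: "?G = {?r + 1}" using subset_singletonD[OF *] assms(4) by (metis card.empty zero_neq_one)
  have "?r + 1 \<in> ?G" by (simp add: G)
  then have "?r \<notin> S" "?r + 1 \<in> S" by (auto simp: gap_tops_def)
  \<comment> \<open>Undo the lowering: the only element that moved went from \<open>?r + 1\<close>
    to \<open>?r\<close>.\<close>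
  have "S - {?r + 1} = lower_gaps S - {?r}"
    using \<open>?r \<notin> S\<close> unfolding lower_gaps_def G by auto
  also have "\<dots> = {1..?r - 1}" unfolding eq by auto
  finally show ?thesis using \<open>?r + 1 \<in> S\<close> by blast
qed

section \<open>The extremal partition\<close>

lemma sum_mset_mset_set: "sum_mset (mset_set A) = \<Sum>A"
  by (simp add: sum_unfold_sum_mset)

lemma sum_mset_ge_sum_set: "\<Sum>(set_mset p) \<le> sum_mset (p :: nat multiset)"
proof -
  have "mset_set (set_mset p) \<subseteq># p" by (rule mset_set_set_mset_msubset)
  then have "sum_mset (mset_set (set_mset p)) \<le> sum_mset p"
    by (metis le_add1 subset_mset.add_diff_inverse sum_mset.union)
  then show ?thesis by (simp add: sum_mset_mset_set)
qed

text \<open>The copies beyond the first of each size have the repeated sizes as support, which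
  bounds their sum from below by a triangular number.\<close>

lemma set_mset_excess: "set_mset (p - mset_set (set_mset p)) = repeated p"
proof (intro set_eqI)
  fix x
  show "x \<in># p - mset_set (set_mset p) \<longleftrightarrow> x \<in> repeated p"
  proof (cases "x \<in># p")
    case True
    then have "count p x > 0" by simp
    then have "1 < count p x \<longleftrightarrow> count p x \<noteq> 1" by linarith
    then show ?thesis using True by (simp add: repeated_def in_diff_count)
  next
    case False
    then show ?thesis by (auto simp: repeated_def dest: in_diffD)
  qed
qed

abbreviation extremal :: "nat \<Rightarrow> nat multiset" where
  "extremal s \<equiv> {#s + 1#} + mset_set {2..s - 1} + {#1, 1#}"

lemma extremal_alt:
  assumes "s \<ge> 2"
  shows "extremal s = mset_set (insert (s + 1) {1..s - 1}) + {#1#}"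
proof -
  have "{1..s - 1} = insert 1 {2..s - 1}" using assms by auto
  moreover have "mset_set (insert (s + 1) (insert 1 {2..s - 1})) =
      add_mset (s + 1) (add_mset 1 (mset_set {2..s - 1}))"
    using assms by (subst mset_set.insert) auto
  ultimately show ?thesis by simp
qed

lemma extremal_in_partitions:
  assumes "s \<ge> 2"
  shows "extremal s \<in> partitions (triangular s + 2)"
proof -
  obtain t where "s = Suc t" using assms by (cases s) auto
  then have "sum_mset (extremal s) = triangular s + 2"
    unfolding extremal_alt[OF assms] by (simp add: triangular_eq_sum sum_mset_mset_set)
  then show ?thesis by (auto simp: partitions_def)
qed

text \<open>There are \<open>s\<close> sizes, \<open>1\<close> is repeated, and \<open>s + 1\<close>
  is a gap top since \<open>s\<close> is missing.\<close>

lemma deg_extremal: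
  assumes "s \<ge> 2"
  shows "s * (s - 1) + 2 \<le> deg (triangular s + 2) (extremal s)"
proof -
  let ?S = "set_mset (extremal s)"
  have S: "?S = insert (s + 1) {1..s - 1}" unfolding extremal_alt[OF assms] using assms by auto
  have r: "card ?S = s" unfolding S using assms by simp
  have "s + 1 \<in> gap_tops ?S" unfolding S gap_tops_def using assms by auto
  moreover have "finite (gap_tops ?S)" by (simp add: gap_tops_def)
  ultimately have g: "card (gap_tops ?S) \<ge> 1"
    using card_gt_0_iff[of "gap_tops ?S"] by fastforce
  have "1 \<in> repeated (extremal s)" by (simp add: repeated_def)
  moreover have "finite (repeated (extremal s))" by (simp add: repeated_def)
  ultimately have m: "card (repeated (extremal s)) \<ge> 1"
    using card_gt_0_iff[of "repeated (extremal s)"] by fastforce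
  have "s * s = s * (s - 1) + s" using assms by (cases s) auto
  then show ?thesis using deg_formula[OF extremal_in_partitions[OF assms]] r g m by simp
qed

text \<open>Stated with a degree threshold that \<open>extremal s\<close> reaches, so that
  optimality and uniqueness follow together.\<close>

lemma eq_extremal_of_deg_ge:
  assumes s: "s \<ge> 2" and p: "p \<in> partitions (triangular s + 2)"
    and deg: "s * (s - 1) + 2 \<le> deg (triangular s + 2) p"
  shows "p = extremal s"
proof -
  define S where "S = set_mset p"
  define E where "E = p - mset_set S"
  have S: "finite S" "0 \<notin> S" and sum: "sum_mset p = triangular s + 2"
    using p by (auto simp: S_def partitions_def)
  have p_eq: "p = mset_set S + E"
    unfolding E_def S_def
    by (rule subset_mset.add_diff_inverse[OF mset_set_set_mset_msubset, symmetric])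
  have set_E: "set_mset E = repeated p" unfolding E_def S_def by (rule set_mset_excess)
  have sum_eq: "\<Sum>S + sum_mset E = triangular s + 2"
    using arg_cong[OF p_eq, of sum_mset] sum by (simp add: sum_mset_mset_set)
  define r m g where "r = card S" and "m = card (repeated p)" and "g = card (gap_tops S)"
  have formula: "deg (triangular s + 2) p + r = r * r + m + g"
    using deg_formula[OF p] by (simp add: S_def r_def m_def g_def)
  have "m \<le> r" "g \<le> r"
    unfolding m_def g_def r_def using S by (auto simp: repeated_def gap_tops_def S_def intro!: card_mono)
  have S_ge: "triangular r + g \<le> \<Sum>S"
    unfolding r_def g_def by (rule triangular_add_gaps_le[OF S])
  have "0 \<notin> set_mset E" using S by (auto simp: E_def S_def dest: in_diffD)
  then have E_ge: "triangular m \<le> sum_mset E"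
    using sum_ge_triangular[OF finite_set_mset[of E]] sum_mset_ge_sum_set[of E]
    unfolding m_def set_E[symmetric] by linarith
  have "r \<le> s"
  proof (rule ccontr)
    assume "\<not> r \<le> s"
    \<comment> \<open>\<open>triangular (Suc s)\<close> exceeds \<open>triangular s\<close> by
      \<open>s + 1\<close>, which is at least \<open>3\<close> and so more than the available
      \<open>2\<close>.\<close>
    then have "triangular (Suc s) \<le> triangular r" by (intro triangular_mono) simp
    then show False using S_ge sum_eq s by (simp add: triangular_Suc)
  qed
  moreover have "\<not> r < s"
  proof
    assume "r < s"
    \<comment> \<open>As \<open>m\<close> and \<open>g\<close> are at most \<open>r\<close>, the
      degree is at most \<open>r * (r + 1)\<close>, two short of the threshold.\<close>
    then have "r * (r + 1) \<le> (s - 1) * s" by (intro mult_le_mono) auto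
    then show False using formula deg \<open>m \<le> r\<close> \<open>g \<le> r\<close> by (simp add: algebra_simps)
  qed
  ultimately have r: "r = s" by simp
  have "s * s = s * (s - 1) + s" using s by (cases s) auto
  then have mg: "m + g \<ge> 2" using formula deg r by simp
  \<comment> \<open>Repetitions and gaps share the excess \<open>2\<close> over
    \<open>triangular s\<close>; two repeated sizes would already cost
    \<open>triangular 2 = 3\<close>.\<close>
  have "triangular m + g \<le> 2" using S_ge E_ge sum_eq r by simp
  moreover have "m \<le> triangular m" by (cases m) (auto simp: triangular_Suc)
  moreover have "m \<noteq> 2" using calculation by (auto simp: triangular_def)
  ultimately consider "m = 1" "g = 1" | "g = 2" using mg by linarith
  then show ?thesis
  proof cases
    case 1
    then have "sum_mset E \<ge> 1" using E_ge by (simp add: triangular_def)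
    \<comment> \<open>The extra copies take at least \<open>1\<close>, leaving \<open>S\<close> a
      sum of at most \<open>triangular s + 1\<close>, tight for one gap.\<close>
    then have "S = insert (s + 1) {1..s - 1}"
      using eq_of_tight_sum_one_gap[OF S] sum_eq 1 r by (simp add: r_def g_def)
    moreover have "E = {#1#}"
    proof -
      obtain x where x: "set_mset E = {x}" using 1 set_E m_def by (metis card_1_singletonE)
      have "sum_mset E = 1" using S_ge r 1 sum_eq \<open>sum_mset E \<ge> 1\<close> by simp
      moreover obtain F where F: "E = add_mset x F" using x by (metis insertI1 mset_add)
      ultimately have "x = 1" "sum_mset F = 0"
        using x \<open>0 \<notin> set_mset E\<close> by (auto simp: add_is_1)
      moreover have "F = {#}"
        using \<open>sum_mset F = 0\<close> \<open>0 \<notin> set_mset E\<close> F by (cases F) auto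
      ultimately show ?thesis using F by simp
    qed
    ultimately show ?thesis using p_eq extremal_alt[OF s] by simp
  next
    case 2
    \<comment> \<open>Two gaps would use up the whole excess, but a tight sum leaves room for a
      single gap top.\<close>
    then have "gap_tops S \<subseteq> {card S + 1}"
      using gap_tops_of_tight_sum(1)[OF S] sum_eq r by (simp add: r_def g_def)
    then have "g \<le> 1" unfolding g_def by (metis card_mono finite.emptyI finite.insertI is_singletonI is_singleton_altdef)
    then show ?thesis using 2 by simp
  qed
qed

theorem proposition4p3:
  fixes s :: nat
  assumes "s \<ge> 2"
  shows "(\<forall>p. degree_maximizing (triangular s + 2) p \<longleftrightarrow>
            p = {#s + 1#} + mset_set {2..s - 1} + {#1, 1#}) \<and>
         card {p. degree_maximizing (triangular s + 2) p} = 1"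
proof -
  let ?n = "triangular s + 2"
  have fin: "finite (deg ?n ` partitions ?n)" by (simp add: finite_partitions)
  have max: "deg ?n (extremal s) \<le> max_deg ?n"
    unfolding max_deg_def by (intro Max_ge fin imageI extremal_in_partitions assms)
  have only: "p = extremal s" if "degree_maximizing ?n p" for p
    using that eq_extremal_of_deg_ge[OF assms, of p] deg_extremal[OF assms] max
    by (simp add: degree_maximizing_def)
  \<comment> \<open>The maximum is attained, and by \<open>only\<close> the partition attaining it
    is \<open>extremal s\<close>; this turns \<open>only\<close> into an equivalence.\<close>
  have "max_deg ?n \<in> deg ?n ` partitions ?n"
    unfolding max_deg_def using extremal_in_partitions[OF assms] by (intro Max_in fin) auto
  then obtain q where q: "degree_maximizing ?n q" by (auto simp: degree_maximizing_def)
  have iff: "degree_maximizing ?n p \<longleftrightarrow> p = extremal s" for p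
    using only q by metis
  then show ?thesis by simp
qed

end
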